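(* Let $A\in\mathbb{R}^{n\times n}$ and $B\in\mathbb{R}^{m\times m}$ be symmetric positive definite, let $0\le\alpha\le 1/2$, let $k=\min(m,n)$, and let $M\in\mathbb{R}^{m\times n}$ with $M\ne0$. Put $$C_\alpha=B^{-\alpha}MA^{-\alpha},\qquad D_{\alpha,0}=B^{-\alpha}Q(C_\alpha)A^{-\alpha},\qquad \widehat D_\alpha=D_{\alpha,0}\,\frac{\sqrt{k}}{\|D_{\alpha,0}\|_F},$$ where $Q(C_\alpha)$ is a compact full-SVD support polar of $C_\alpha$. Let $K_{AB}=\kappa_2(A)\kappa_2(B)$. Then $$\langle M,\widehat D_\alpha\rangle\ \ge\ K_{AB}^{-\alpha}\,\|M\|_*,\qquad \kappa_+(\widehat D_\alpha)\ \le\ K_{AB}^{\alpha}.$$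
   Context: $\langle X,Y\rangle=\operatorname{tr}(X^\top Y)$; $\|\cdot\|_F$ is the Frobenius norm and $\|\cdot\|_*$ the nuclear norm. $\kappa_2(X)=\sigma_{\max}(X)/\sigma_{\min}(X)$ is the spectral condition number of an invertible matrix, and $\kappa_+(X)$ is the ratio of the largest to the smallest nonzero singular value of a nonzero matrix $X$. A compact full-SVD support polar of $C\in\mathbb{R}^{m\times n}$ is $Q(C)=UV^\top$, where $C=U\Sigma V^\top$ is a compact SVD with $U\in\mathbb{R}^{m\times k}$, $V\in\mathbb{R}^{n\times k}$ having orthonormal columns, $k=\min(m,n)$, and $\Sigma\in\mathbb{R}^{k\times k}$ diagonal with nonnegative entries (some possibly zero if $C$ is rank deficient). Thus $Q(C)$ is semi-orthogonal (all $k$ of its singular values equal $1$) and $Q(C)\in\arg\max_{\|U\|_{\mathrm{op}}\le1}\langle C,U\rangle$. *)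

theory Defs
  imports "HOL-Analysis.Analysis"
begin

text \<open>An \<open>m \<times> n\<close> real matrix has type \<open>real^'n^'m\<close>. On this type the library's
  \<^const>\<open>norm\<close> is the Frobenius norm (it is not an operator norm), as the next lemma records.\<close>

lemma inner_eq_trace_transpose:
  fixes X Y :: "real^'n^'m"
  shows "inner X Y = trace (transpose X ** Y)"
  unfolding inner_vec_def trace_def transpose_def matrix_matrix_mult_def
  by (simp, rule sum.swap)

lemma norm_eq_sqrt_trace:
  fixes X :: "real^'n^'m"
  shows "norm X = sqrt (trace (transpose X ** X))"
  by (simp add: norm_eq_sqrt_inner inner_eq_trace_transpose)

definition symmetric_positive_definite :: "real^'n^'n \<Rightarrow> bool" where
  "symmetric_positive_definite A \<longleftrightarrow>
     transpose A = A \<and> (\<forall>x. x \<noteq> 0 \<longrightarrow> inner x (A *v x) > 0)"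

definition diag_matrix :: "real^'n \<Rightarrow> real^'n^'n" where
  "diag_matrix d = (\<chi> i j. if i = j then d $ i else 0)"

text \<open>Real powers of a symmetric positive definite matrix, by functional calculus on an
  orthogonal eigendecomposition. The result does not depend on the decomposition.\<close>

definition spd_powr :: "real^'n^'n \<Rightarrow> real \<Rightarrow> real^'n^'n" where
  "spd_powr A s = (THE P. \<exists>W d. orthogonal_matrix W \<and>
      A = W ** diag_matrix d ** transpose W \<and>
      P = W ** diag_matrix (\<chi> i. d $ i powr s) ** transpose W)"

text \<open>Singular values as a set, via unit left and right singular vectors. For \<open>\<sigma> = 0\<close> both
  vectors must exist, so \<open>0\<close> belongs to the set exactly when the rank of \<open>X\<close> is less than
  \<open>min m n\<close>, i.e. when it occurs among the \<open>min m n\<close> diagonal entries of a compact SVD.\<close>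

definition singular_values :: "real^'n^'m \<Rightarrow> real set" where
  "singular_values X = {\<sigma>. \<sigma> \<ge> 0 \<and> (\<exists>u v. norm u = 1 \<and> norm v = 1 \<and>
      X *v v = \<sigma> *\<^sub>R u \<and> transpose X *v u = \<sigma> *\<^sub>R v)}"

text \<open>The sum of the singular values with multiplicity. The multiplicity of \<open>\<sigma> > 0\<close> is the
  dimension of the eigenspace of \<open>X\<^sup>T X\<close> for \<open>\<sigma>\<^sup>2\<close>; the term for \<open>\<sigma> = 0\<close> vanishes.\<close>

definition nuclear_norm :: "real^'n^'m \<Rightarrow> real" where
  "nuclear_norm X = (\<Sum>\<sigma>\<in>singular_values X.
      real (dim {v. (transpose X ** X) *v v = \<sigma>\<^sup>2 *\<^sub>R v}) * \<sigma>)"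

text \<open>Spectral condition number; meaningful for invertible matrices.\<close>

definition cond2 :: "real^'n^'n \<Rightarrow> real" where
  "cond2 X = Max (singular_values X) / Min (singular_values X)"

text \<open>Ratio of the extreme nonzero singular values; meaningful for nonzero matrices.\<close>

definition cond_plus :: "real^'n^'m \<Rightarrow> real" where
  "cond_plus X = Max (singular_values X - {0}) / Min (singular_values X - {0})"

text \<open>The index type \<open>'k\<close> of the inner dimension must have \<open>min m n\<close> elements. Zero diagonal
  entries are allowed, so the factors are in general not determined by \<open>C\<close>, and neither
  is the support polar \<open>U V\<^sup>T\<close>.\<close>

definition compact_svd ::
    "real^'n^'m \<Rightarrow> real^'k^'m \<Rightarrow> real^'k^'k \<Rightarrow> real^'k^'n \<Rightarrow> bool" where
  "compact_svd C U S V \<longleftrightarrow>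
     CARD('k) = min CARD('m) CARD('n) \<and>
     transpose U ** U = mat 1 \<and> transpose V ** V = mat 1 \<and>
     (\<forall>i j. i \<noteq> j \<longrightarrow> S $ i $ j = 0) \<and> (\<forall>i. S $ i $ i \<ge> 0) \<and>
     C = U ** S ** transpose V"

end

theory Submission
  imports Defs
begin

text \<open>Write \<open>P\<close> and \<open>R\<close> for the powers of \<open>B\<close> and \<open>A\<close> with exponent \<open>-\<alpha>\<close>. By symmetry of \<open>P\<close>
  and \<open>R\<close>, the pairing of \<open>M\<close> with \<open>D0 = P Q R\<close> equals the pairing of \<open>C = P M R\<close> with \<open>Q\<close>,
  which is the trace of \<open>S\<close>. Recovering \<open>M\<close> from \<open>C\<close> with the inverses of \<open>P\<close> and \<open>R\<close>, expanding
  the nuclear norm of \<open>M\<close> over orthonormal singular vectors and using the Cauchy-Schwarz and Bessel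
  inequalities bounds it by the trace of \<open>S\<close> times the largest eigenvalues of \<open>A\<close> and \<open>B\<close> to the
  power \<open>\<alpha>\<close>, while the Frobenius norm of \<open>D0\<close> is at most \<open>\<surd>k\<close> times the smallest eigenvalues to
  the power \<open>-\<alpha>\<close>. For the condition number, \<open>Q\<close> is an isometry on the side of the smaller
  dimension, so every singular value of \<open>P Q R\<close> lies between the products of the extreme singular
  values of \<open>P\<close> and \<open>R\<close>.\<close>

subsection \<open>The spectral theorem\<close>

lemma inner_matrix_vector_mult:
  fixes A :: "real^'n^'m"
  shows "inner (A *v x) y = inner x (transpose A *v y)"
  by (metis dot_lmul_matrix inner_commute transpose_matrix_vector)

lemma norm_orthonormal_columns_mult:
  fixes U :: "real^'k^'m"
  assumes "transpose U ** U = mat 1"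
  shows "norm (U *v x) = norm x"
  unfolding norm_eq_sqrt_inner inner_matrix_vector_mult matrix_vector_mul_assoc assms by simp

text \<open>A maximiser \<open>u\<close> of the quadratic form on the unit sphere of
  \<open>S\<close> is an eigenvector: the residual \<open>z = f u - c u\<close> stays in
  \<open>S\<close> and is orthogonal to \<open>u\<close>, and moving along it would increase the
  Rayleigh quotient unless it vanishes.\<close>

lemma symmetric_eigenvector_in_subspace:
  fixes f :: "'a::euclidean_space \<Rightarrow> 'a"
  assumes f: "linear f" and sym: "\<And>x y. inner (f x) y = inner x (f y)"
    and S: "subspace S" "S \<noteq> {0}" and inv: "\<And>x. x \<in> S \<Longrightarrow> f x \<in> S"
  obtains u c where "u \<in> S" "norm u = 1" "f u = c *\<^sub>R u"
proof -
  let ?K = "S \<inter> sphere 0 1"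
  obtain x where x: "x \<in> S" "x \<noteq> 0"
    using S subspace_0 by blast
  then have "x /\<^sub>R norm x \<in> ?K"
    using S(1) by (simp add: subspace_scale)
  then have "?K \<noteq> {}" by blast
  moreover have "compact ?K"
    by (simp add: S(1) closed_subspace closed_Int_compact)
  moreover have "continuous_on ?K (\<lambda>x. inner x (f x))"
    by (intro continuous_intros linear_continuous_on f linear_conv_bounded_linear[THEN iffD1])
  ultimately obtain u where u: "u \<in> ?K" and max: "\<And>y. y \<in> ?K \<Longrightarrow> inner y (f y) \<le> inner u (f u)"
    using continuous_attains_sup by meson
  define c where "c = inner u (f u)"
  have nu: "norm u = 1" "inner u u = 1" and uS: "u \<in> S"
    using u by (auto simp: norm_eq_1)
  have le: "inner y (f y) \<le> c * inner y y" if "y \<in> S" for y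
  proof (cases "y = 0")
    case False
    have "y /\<^sub>R norm y \<in> ?K"
      using False that S(1) by (simp add: subspace_scale)
    from max[OF this] have "inner y (f y) / (norm y)\<^sup>2 \<le> c"
      using linear_scale[OF f] by (simp add: c_def power2_eq_square divide_inverse mult_ac)
    then show ?thesis
      using False by (simp add: divide_le_eq power2_norm_eq_inner)
  qed (simp add: linear_0 f)
  define z where "z = f u - c *\<^sub>R u"
  have zS: "z \<in> S"
    unfolding z_def using uS inv S(1) by (simp add: subspace_diff subspace_scale)
  have uz: "inner u z = 0"
    by (simp add: z_def inner_diff_right nu c_def)
  define g where "g = inner z z"
  define e where "e = c * g - inner z (f z)"
  \<comment> \<open>\<open>le\<close> is tested at \<open>u + t z\<close>. The left side is linear
    and the right side quadratic in \<open>t\<close>, so a small positive \<open>t\<close>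
    contradicts \<open>g > 0\<close>.\<close>
  have quad: "2 * t * g \<le> t\<^sup>2 * e" for t
  proof -
    have "u + t *\<^sub>R z \<in> S"
      using uS zS S(1) by (simp add: subspace_add subspace_scale)
    from le[OF this] have "c + 2 * t * inner z (f u) + t\<^sup>2 * inner z (f z) \<le> c * (1 + t\<^sup>2 * g)"
      using sym[of u z] uz
      by (simp add: linear_add[OF f] linear_scale[OF f] inner_add_left inner_add_right c_def
          nu g_def inner_commute[of z u] inner_commute[of "f u" z] power2_eq_square algebra_simps)
    moreover have "inner z (f u) = g"
    proof -
      have "f u = z + c *\<^sub>R u" by (simp add: z_def)
      then show ?thesis using uz by (simp add: inner_add_right g_def inner_commute)
    qed
    ultimately show ?thesis by (simp add: e_def algebra_simps)
  qed
  have "g = 0"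
  proof (rule ccontr)
    assume "g \<noteq> 0"
    then have "g > 0" by (simp add: g_def)
    \<comment> \<open>The choice \<open>t = g / r\<close> turns \<open>quad\<close> into
      \<open>2 r \<le> e\<close>, which \<open>r = 1 + |e|\<close> excludes.\<close>
    define r where "r = 1 + \<bar>e\<bar>"
    have r: "r > 0" "e < 2 * r" by (auto simp: r_def)
    have "2 * (g / r) * g * r\<^sup>2 \<le> (g / r)\<^sup>2 * e * r\<^sup>2"
      using quad[of "g / r"] by (intro mult_right_mono) auto
    then have "g\<^sup>2 * (2 * r) \<le> g\<^sup>2 * e"
      using r(1) by (simp add: power2_eq_square mult_ac)
    then have "2 * r \<le> e"
      using \<open>g > 0\<close> by simp
    then show False using r(2) by linarith
  qed
  then have "f u = c *\<^sub>R u" by (simp add: g_def z_def)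
  with nu uS that show thesis by blast
qed

text \<open>An orthonormal set of eigenvectors of largest cardinality spans the space: otherwise its
  orthogonal complement is nonzero and, by symmetry, invariant under \<open>f\<close>, so it
  contributes one more unit eigenvector.\<close>

lemma symmetric_orthonormal_eigenbasis:
  fixes f :: "'a::euclidean_space \<Rightarrow> 'a"
  assumes f: "linear f" and sym: "\<And>x y. inner (f x) y = inner x (f y)"
  obtains B where "pairwise orthogonal B" "\<And>b. b \<in> B \<Longrightarrow> norm b = 1" "finite B" "card B = DIM('a)"
    "\<And>b. b \<in> B \<Longrightarrow> \<exists>c. f b = c *\<^sub>R b"
proof -
  define P where "P B \<longleftrightarrow> pairwise orthogonal B \<and> (\<forall>b\<in>B. norm b = 1 \<and> (\<exists>c. f b = c *\<^sub>R b))" for B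
  have ind: "independent B" if "P B" for B
    using that pairwise_orthogonal_independent[of B] by (force simp: P_def)
  have bd: "card B \<le> DIM('a)" "finite B" if "P B" for B
    using independent_bound[OF ind[OF that]] by auto
  have "P {}" by (simp add: P_def)
  then obtain B where B: "P B" and max: "\<And>B'. P B' \<Longrightarrow> card B' \<le> card B"
    using ex_has_greatest_nat[of P "{}" card "Suc DIM('a)"] bd(1) by (auto simp: less_Suc_eq_le)
  have fin: "finite B" by (rule bd(2)[OF B])
  have "card B = DIM('a)"
  proof (rule ccontr)
    assume "card B \<noteq> DIM('a)"
    then have "dim (span B) < DIM('a)"
      using ind[OF B] bd[OF B] by (simp add: dim_eq_card_independent)
    then have "span B \<noteq> UNIV" by (metis dim_UNIV less_irrefl)
    then obtain y where y: "y \<noteq> 0" "\<And>x. x \<in> span B \<Longrightarrow> orthogonal y x"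
      using orthogonal_to_subspace_exists_gen[of B UNIV] by (auto simp: psubset_eq)
    define S where "S = {x. \<forall>b\<in>B. inner b x = 0}"
    have "subspace S"
      by (auto simp: S_def subspace_def inner_add_right)
    moreover have "y \<in> S"
      using y(2) span_base by (auto simp: S_def orthogonal_def inner_commute)
    then have "S \<noteq> {0}" using y(1) by blast
    moreover have "f x \<in> S" if "x \<in> S" for x
    proof -
      have "inner b (f x) = 0" if "b \<in> B" for b
      proof -
        obtain c where "f b = c *\<^sub>R b" using B \<open>b \<in> B\<close> unfolding P_def by blast
        then have "inner (f b) x = 0" using \<open>x \<in> S\<close> that by (simp add: S_def)
        then show ?thesis by (simp only: sym)
      qed
      then show ?thesis by (simp add: S_def)
    qed
    ultimately obtain u c where u: "u \<in> S" "norm u = 1" "f u = c *\<^sub>R u"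
      using symmetric_eigenvector_in_subspace[OF f sym, of S] by blast
    have "u \<notin> B"
      using u by (auto simp: S_def)
    moreover have "P (insert u B)"
      using B u by (auto simp: P_def pairwise_insert orthogonal_def S_def inner_commute)
    ultimately show False using max[of "insert u B"] fin by simp
  qed
  then show thesis using B fin that by (auto simp: P_def)
qed

lemma diag_matrix_mult_vec: "(diag_matrix d *v x) $ i = d $ i * x $ i"
  by (simp add: diag_matrix_def matrix_vector_mult_def if_distrib[where f="\<lambda>a. a * _"] cong: if_cong)

lemma transpose_diag_matrix [simp]: "transpose (diag_matrix d) = diag_matrix d"
  by (auto simp: diag_matrix_def transpose_def vec_eq_iff)

text \<open>The orthonormal eigenvectors, enumerated by the index type, become the columns of
  \<open>W\<close>. The eigenvalue equations then read
  \<open>A ** W = W ** diag_matrix d\<close>.\<close>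

lemma spectral_decomposition:
  fixes A :: "real^'n^'n"
  assumes "transpose A = A"
  obtains W d where "orthogonal_matrix W" "A = W ** diag_matrix d ** transpose W"
proof -
  have sym: "inner (A *v x) y = inner x (A *v y)" for x y
    by (metis assms inner_matrix_vector_mult)
  obtain B where B: "pairwise orthogonal B" "\<And>b. b \<in> B \<Longrightarrow> norm b = 1" "finite B"
      "card B = CARD('n)" "\<And>b. b \<in> B \<Longrightarrow> \<exists>c. A *v b = c *\<^sub>R b"
    using symmetric_orthonormal_eigenbasis[OF matrix_vector_mul_linear, of A] sym
    by (metis DIM_cart DIM_real mult.right_neutral)
  obtain w where w: "bij_betw w (UNIV :: 'n set) B"
    using B(3,4) by (metis bij_betw_iff_card finite)
  have wB: "w j \<in> B" for j using w by (simp add: bij_betw_apply)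
  obtain c where c: "\<And>j. A *v w j = c j *\<^sub>R w j"
    using B(5)[OF wB] by metis
  define W where "W = (\<chi> i j. w j $ i)"
  define d where "d = (\<chi> j. c j)"
  have col: "column j W = w j" for j
    by (simp add: W_def column_def vec_eq_iff)
  have orth: "orthogonal_matrix W"
    unfolding orthogonal_matrix_orthonormal_columns col
    using B(1,2) wB w by (simp add: pairwise_def bij_betw_def inj_eq)
  have "A ** W = W ** diag_matrix d"
  proof -
    have "(A ** W) $ i $ j = (W ** diag_matrix d) $ i $ j" for i j
    proof -
      have "(A ** W) $ i $ j = (A *v w j) $ i"
        by (simp add: matrix_matrix_mult_def matrix_vector_mult_def W_def)
      also have "\<dots> = c j * w j $ i" by (simp add: c)
      also have "\<dots> = (W ** diag_matrix d) $ i $ j"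
        by (simp add: matrix_matrix_mult_def W_def d_def diag_matrix_def if_distrib mult.commute cong: if_cong)
      finally show ?thesis .
    qed
    then show ?thesis by (simp add: vec_eq_iff)
  qed
  then have "A = W ** diag_matrix d ** transpose W"
    using orth by (metis matrix_mul_assoc matrix_mul_rid orthogonal_matrix_def)
  with orth that show thesis by blast
qed

text \<open>The description in \<open>spd_powr\<close> determines a unique matrix. For two
  decompositions, \<open>T = transpose W' ** W\<close> intertwines the diagonal matrices, so
  \<open>T $ i $ j\<close> can be nonzero only where \<open>d' $ i = d $ j\<close>; hence it also
  intertwines their entrywise powers.\<close>

lemma spd_powr_eq:
  fixes W :: "real^'n^'n"
  assumes W: "orthogonal_matrix W" and A: "A = W ** diag_matrix d ** transpose W"
  shows "spd_powr A s = W ** diag_matrix (\<chi> i. d $ i powr s) ** transpose W"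
  unfolding spd_powr_def
proof (rule the_equality)
  fix P
  assume "\<exists>W d. orthogonal_matrix W \<and> A = W ** diag_matrix d ** transpose W \<and>
      P = W ** diag_matrix (\<chi> i. d $ i powr s) ** transpose W"
  then obtain W' d' where W': "orthogonal_matrix W'" "A = W' ** diag_matrix d' ** transpose W'"
    and P: "P = W' ** diag_matrix (\<chi> i. d' $ i powr s) ** transpose W'" by blast
  define T where "T = transpose W' ** W"
  have WW: "transpose W ** W = mat 1" "W ** transpose W = mat 1"
    "transpose W' ** W' = mat 1" "W' ** transpose W' = mat 1"
    using W W'(1) by (auto simp: orthogonal_matrix_def)
  have mul: "(diag_matrix e ** T) $ i $ j = e $ i * T $ i $ j"
    "(T ** diag_matrix e) $ i $ j = T $ i $ j * e $ j" for e i j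
    by (simp_all add: matrix_matrix_mult_def diag_matrix_def if_distrib[where f="\<lambda>a. a * _"] if_distrib[where f="\<lambda>a. _ * a"] cong: if_cong)
  have "diag_matrix d' ** T = transpose W' ** A ** W"
    unfolding W'(2) T_def by (simp add: matrix_mul_assoc WW)
  also have "\<dots> = T ** diag_matrix d"
    unfolding A T_def by (simp add: matrix_mul_assoc[symmetric] WW)
  finally have "d' $ i * T $ i $ j = T $ i $ j * d $ j" for i j
    by (metis mul)
  then have "T $ i $ j = 0 \<or> d' $ i = d $ j" for i j
    by (metis mult.commute mult_cancel_left)
  then have "diag_matrix (\<chi> i. d' $ i powr s) ** T = T ** diag_matrix (\<chi> i. d $ i powr s)"
    unfolding vec_eq_iff mul by force
  then have "W' ** (diag_matrix (\<chi> i. d' $ i powr s) ** T) ** transpose W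
      = W' ** (T ** diag_matrix (\<chi> i. d $ i powr s)) ** transpose W" by simp
  then have "P ** (W ** transpose W)
      = (W' ** transpose W') ** (W ** diag_matrix (\<chi> i. d $ i powr s) ** transpose W)"
    by (simp only: P T_def matrix_mul_assoc)
  then show "P = W ** diag_matrix (\<chi> i. d $ i powr s) ** transpose W"
    by (simp add: WW)
qed (use W A in blast)

text \<open>Both \<open>W\<close> and its transpose preserve norms, so only the diagonal factor
  matters, and its effect on the squared norm is compared coordinate by coordinate.\<close>

lemma diag_matrix_norm_bounds:
  fixes W :: "real^'n^'n"
  assumes W: "orthogonal_matrix W" and "0 \<le> a" "\<And>i. a \<le> d $ i" "\<And>i. d $ i \<le> b"
  shows "a * norm x \<le> norm ((W ** diag_matrix d ** transpose W) *v x)"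
    and "norm ((W ** diag_matrix d ** transpose W) *v x) \<le> b * norm x"
proof -
  have iso: "norm (W *v y) = norm y" "norm (transpose W *v y) = norm y" for y
    using W norm_orthonormal_columns_mult[of W y] norm_orthonormal_columns_mult[of "transpose W" y]
    unfolding orthogonal_matrix_def transpose_transpose by blast+
  define y where "y = transpose W *v x"
  have ny: "norm y = norm x" by (simp only: y_def iso)
  have eq: "norm ((W ** diag_matrix d ** transpose W) *v x) = norm (diag_matrix d *v y)"
    by (simp only: y_def matrix_vector_mul_assoc[symmetric] iso)
  have sq: "(norm v)\<^sup>2 = (\<Sum>i\<in>UNIV. (v $ i)\<^sup>2)" for v :: "real^'n"
    unfolding power2_norm_eq_inner by (simp add: inner_vec_def power2_eq_square)
  have d: "0 \<le> d $ i" for i using assms(2) assms(3)[of i] by linarith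
  then have b: "0 \<le> b" using assms(4) order_trans by blast
  have "(a * norm y)\<^sup>2 \<le> (norm (diag_matrix d *v y))\<^sup>2"
    unfolding sq power_mult_distrib diag_matrix_mult_vec sum_distrib_left
    by (intro sum_mono mult_right_mono power_mono assms) auto
  moreover have "(norm (diag_matrix d *v y))\<^sup>2 \<le> (b * norm y)\<^sup>2"
    unfolding sq power_mult_distrib diag_matrix_mult_vec sum_distrib_left
    by (intro sum_mono mult_right_mono power_mono assms d) auto
  ultimately show "a * norm x \<le> norm ((W ** diag_matrix d ** transpose W) *v x)"
    "norm ((W ** diag_matrix d ** transpose W) *v x) \<le> b * norm x"
    unfolding eq ny[symmetric] using b by (meson power2_le_imp_le mult_nonneg_nonneg norm_ge_zero)+
qed

subsection \<open>Powers of positive definite matrices\<close>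

text \<open>Since \<open>A\<close> is symmetric, a column of \<open>W\<close> serves as both left
  and right singular vector for its eigenvalue. Conversely, adding the two singular vector equations
  in the coordinates of \<open>W\<close> forces \<sigma> to be an eigenvalue.\<close>

lemma singular_values_spd:
  fixes W :: "real^'n^'n"
  assumes W: "orthogonal_matrix W" and A: "A = W ** diag_matrix d ** transpose W" and d: "\<And>i. 0 < d $ i"
  shows "singular_values A = range (($) d)"
proof -
  have WW: "transpose W ** W = mat 1" "W ** transpose W = mat 1"
    using W by (auto simp: orthogonal_matrix_def)
  have At: "transpose A = A"
    by (simp add: A matrix_transpose_mul matrix_mul_assoc)
  have WA: "transpose W ** A = diag_matrix d ** transpose W"
    unfolding A by (simp add: matrix_mul_assoc WW)
  show ?thesis
  proof (intro equalityI subsetI)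
    fix \<sigma> assume "\<sigma> \<in> singular_values A"
    then obtain u v where "\<sigma> \<ge> 0" and v: "norm v = 1"
      and uv: "A *v v = \<sigma> *\<^sub>R u" "A *v u = \<sigma> *\<^sub>R v"
      by (auto simp: singular_values_def At simp del: transpose_matrix_vector)
    define y where "y = transpose W *v v"
    define z where "z = transpose W *v u"
    have "diag_matrix d *v y = \<sigma> *\<^sub>R z" "diag_matrix d *v z = \<sigma> *\<^sub>R y"
      unfolding y_def z_def matrix_vector_mul_assoc WA[symmetric]
      unfolding matrix_vector_mul_assoc[symmetric] uv matrix_vector_mult_scaleR by (rule refl)+
    then have dyz: "d $ i * y $ i = \<sigma> * z $ i" "d $ i * z $ i = \<sigma> * y $ i" for i
      by (metis diag_matrix_mult_vec vector_scaleR_component real_scaleR_def)+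
    have "norm y = 1"
      unfolding y_def using norm_orthonormal_columns_mult[of "transpose W" v] WW v
      by (simp only: transpose_transpose)
    then have "y \<noteq> 0" by auto
    then obtain i where i: "y $ i \<noteq> 0" by (auto simp: vec_eq_iff)
    have "(d $ i - \<sigma>) * (y $ i + z $ i) = 0" using dyz[of i] by (simp add: algebra_simps)
    \<comment> \<open>If the sum vanished, -\<sigma> would equal the eigenvalue
      \<open>d $ i\<close>, against \<open>d $ i > 0\<close> and \<sigma> \<ge> 0.\<close>
    moreover have "y $ i + z $ i \<noteq> 0"
    proof
      assume "y $ i + z $ i = 0"
      then have "z $ i = - y $ i" by simp
      then have "(d $ i + \<sigma>) * y $ i = 0" using dyz(1)[of i] by (simp add: algebra_simps)
      then show False using i d[of i] \<open>\<sigma> \<ge> 0\<close> by simp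
    qed
    ultimately have "\<sigma> = d $ i" by simp
    then show "\<sigma> \<in> range (($) d)" by (rule range_eqI)
  next
    fix \<sigma> assume "\<sigma> \<in> range (($) d)"
    then obtain i where i: "\<sigma> = d $ i" by blast
    define w where "w = W *v axis i 1"
    have "norm w = 1"
      unfolding w_def using norm_orthonormal_columns_mult[OF WW(1), of "axis i 1"] by simp
    moreover have "diag_matrix d *v axis i 1 = \<sigma> *\<^sub>R axis i 1"
      by (simp add: vec_eq_iff diag_matrix_mult_vec i axis_def)
    then have "A *v w = \<sigma> *\<^sub>R w"
      unfolding A w_def matrix_vector_mul_assoc
      by (simp add: matrix_mul_assoc[symmetric] WW) (simp add: matrix_vector_mul_assoc[symmetric] matrix_vector_mult_scaleR)
    ultimately show "\<sigma> \<in> singular_values A"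
      using d[of i] At unfolding singular_values_def i by (auto simp del: transpose_matrix_vector intro: less_imp_le)
  qed
qed

text \<open>Each \<open>d $ i\<close> is the value of the quadratic form of \<open>A\<close> at the
  unit column \<open>W *v axis i 1\<close>, hence positive.\<close>

lemma spd_spectral_decomposition:
  fixes A :: "real^'n^'n"
  assumes "symmetric_positive_definite A"
  obtains W d where "orthogonal_matrix W" "A = W ** diag_matrix d ** transpose W" "\<And>i. 0 < d $ i"
proof -
  obtain W d where W: "orthogonal_matrix W" and A: "A = W ** diag_matrix d ** transpose W"
    using assms spectral_decomposition unfolding symmetric_positive_definite_def by blast
  have WW: "transpose W ** W = mat 1"
    using W by (auto simp: orthogonal_matrix_def)
  have "0 < d $ i" for i
  proof -
    define w where "w = W *v axis i 1"
    have "norm w = 1"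
      unfolding w_def using norm_orthonormal_columns_mult[OF WW, of "axis i 1"] by simp
    then have "0 < inner w (A *v w)"
      using assms unfolding symmetric_positive_definite_def by (metis norm_zero zero_neq_one)
    also have "inner w (A *v w) = inner (axis i 1) (transpose W *v (A *v w))"
      by (simp only: w_def inner_matrix_vector_mult)
    also have "transpose W *v (A *v w) = diag_matrix d *v axis i 1"
      unfolding A w_def matrix_vector_mul_assoc by (simp add: matrix_mul_assoc WW) (simp add: matrix_mul_assoc[symmetric] WW)
    also have "inner (axis i 1) \<dots> = d $ i"
      by (simp add: inner_axis' diag_matrix_mult_vec)
    finally show ?thesis .
  qed
  with W A that show thesis by blast
qed

text \<open>Lets the preconditioning by negative powers be undone, so that the original matrix can
  be recovered from the preconditioned one.\<close>

lemma spd_powr_minus: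
  fixes A :: "real^'n^'n"
  assumes "symmetric_positive_definite A"
  shows "spd_powr A s ** spd_powr A (-s) = mat 1"
proof -
  obtain W d where W: "orthogonal_matrix W" "A = W ** diag_matrix d ** transpose W"
    and d: "\<And>i. 0 < d $ i"
    using spd_spectral_decomposition[OF assms] by blast
  have WW: "transpose W ** W = mat 1" "W ** transpose W = mat 1"
    using W by (auto simp: orthogonal_matrix_def)
  have "diag_matrix (\<chi> i. d $ i powr s) ** diag_matrix (\<chi> i. d $ i powr (-s)) = mat 1"
    using d[THEN less_imp_neq] by (auto simp: vec_eq_iff matrix_matrix_mult_def diag_matrix_def mat_def
        if_distrib[where f="\<lambda>a. a * _"] powr_add[symmetric] cong: if_cong)
  then have "W ** (diag_matrix (\<chi> i. d $ i powr s) ** (transpose W ** W) **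
      diag_matrix (\<chi> i. d $ i powr (-s))) ** transpose W = mat 1"
    by (simp add: WW)
  then show ?thesis
    unfolding spd_powr_eq[OF W] by (simp only: matrix_mul_assoc)
qed

lemma transpose_spd_powr:
  fixes A :: "real^'n^'n"
  assumes "symmetric_positive_definite A"
  shows "transpose (spd_powr A s) = spd_powr A s"
proof -
  obtain W d where W: "orthogonal_matrix W" "A = W ** diag_matrix d ** transpose W"
    using spd_spectral_decomposition[OF assms] by blast
  show ?thesis
    unfolding spd_powr_eq[OF W] by (simp add: matrix_transpose_mul matrix_mul_assoc)
qed

text \<open>The witnesses \<open>l\<close> and \<open>h\<close> are the extreme eigenvalues, and one
  pair serves all exponents. A negative power reverses the order, so \<open>h\<close> gives the
  lower bound and \<open>l\<close> the upper one.\<close>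

lemma spd_powr_norm_bounds:
  fixes A :: "real^'n^'n"
  assumes "symmetric_positive_definite A"
  obtains l h where "0 < l" "0 < h" "cond2 A = h / l"
    "\<And>s x. 0 \<le> s \<Longrightarrow> h powr (-s) * norm x \<le> norm (spd_powr A (-s) *v x)"
    "\<And>s x. 0 \<le> s \<Longrightarrow> norm (spd_powr A (-s) *v x) \<le> l powr (-s) * norm x"
    "\<And>s x. 0 \<le> s \<Longrightarrow> norm (spd_powr A s *v x) \<le> h powr s * norm x"
proof -
  obtain W d where W: "orthogonal_matrix W" "A = W ** diag_matrix d ** transpose W"
    and d: "\<And>i. 0 < d $ i"
    using spd_spectral_decomposition[OF assms] by blast
  define l h where "l = Min (range (($) d))" and "h = Max (range (($) d))"
  have lh: "l \<le> d $ i" "d $ i \<le> h" for i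
    by (simp_all add: l_def h_def)
  have "l \<in> range (($) d)" unfolding l_def by (intro Min_in) auto
  then have l: "0 < l" using d by auto
  moreover have h: "0 < h" using d lh less_le_trans by blast
  moreover have "cond2 A = h / l"
    unfolding cond2_def singular_values_spd[OF W d] l_def h_def ..
  moreover have "h powr (-s) * norm x \<le> norm (spd_powr A (-s) *v x)"
    and "norm (spd_powr A (-s) *v x) \<le> l powr (-s) * norm x" if "0 \<le> s" for s x
  proof -
    have "h powr (-s) \<le> d $ i powr (-s)" "d $ i powr (-s) \<le> l powr (-s)" for i
      using that l d lh by (auto intro!: powr_mono2')
    then show "h powr (-s) * norm x \<le> norm (spd_powr A (-s) *v x)"
      "norm (spd_powr A (-s) *v x) \<le> l powr (-s) * norm x"
      unfolding spd_powr_eq[OF W]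
      by (auto intro!: diag_matrix_norm_bounds[where a = "h powr (-s)" and b = "l powr (-s)"] W(1))
  qed
  \<comment> \<open>Only an upper estimate is wanted here, so the trivial lower bound
    \<open>a = 0\<close> on the entries is supplied.\<close>
  moreover have "norm (spd_powr A s *v x) \<le> h powr s * norm x" if "0 \<le> s" for s x
    unfolding spd_powr_eq[OF W] using that d lh
    by (intro diag_matrix_norm_bounds(2)[where a = 0] W(1)) (auto intro!: powr_mono2 simp: less_imp_le)
  ultimately show thesis using that by blast
qed

subsection \<open>Singular values and the nuclear norm\<close>

text \<open>The squared distance from \<open>x\<close> to its projection \<open>p\<close> is the
  difference of the two sides. Indexed families cover both an orthonormal set and its normalised
  images.\<close>

lemma Bessel_inequality:
  fixes f :: "'i \<Rightarrow> 'a::real_inner"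
  assumes "finite I" and orth: "pairwise (\<lambda>i j. orthogonal (f i) (f j)) I"
    and n1: "\<And>i. i \<in> I \<Longrightarrow> norm (f i) = 1"
  shows "(\<Sum>i\<in>I. (inner x (f i))\<^sup>2) \<le> (norm x)\<^sup>2"
proof -
  define p where "p = (\<Sum>i\<in>I. inner x (f i) *\<^sub>R f i)"
  have "(norm p)\<^sup>2 = (\<Sum>i\<in>I. (norm (inner x (f i) *\<^sub>R f i))\<^sup>2)"
    unfolding p_def using assms(1) orth
    by (intro norm_sum_Pythagorean) (auto simp: pairwise_def orthogonal_def)
  also have "\<dots> = (\<Sum>i\<in>I. (inner x (f i))\<^sup>2)"
    by (simp add: n1)
  finally have np: "(norm p)\<^sup>2 = (\<Sum>i\<in>I. (inner x (f i))\<^sup>2)" .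
  have "inner x p = (\<Sum>i\<in>I. (inner x (f i))\<^sup>2)"
    by (simp add: p_def inner_sum_right power2_eq_square)
  then have "(norm (x - p))\<^sup>2 = (norm x)\<^sup>2 - (\<Sum>i\<in>I. (inner x (f i))\<^sup>2)"
    using np by (simp add: power2_norm_eq_inner inner_diff_left inner_diff_right inner_commute)
  then show ?thesis
    by (metis diff_ge_0_iff_ge zero_le_power2)
qed

lemma singular_value_eigenvector:
  fixes X :: "real^'n^'m"
  assumes "\<sigma> \<in> singular_values X"
  shows "\<exists>v. norm v = 1 \<and> (transpose X ** X) *v v = \<sigma>\<^sup>2 *\<^sub>R v"
proof -
  obtain u v where v: "norm v = 1" "X *v v = \<sigma> *\<^sub>R u" "transpose X *v u = \<sigma> *\<^sub>R v"
    using assms unfolding singular_values_def by blast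
  have "(transpose X ** X) *v v = transpose X *v (X *v v)"
    by (simp only: matrix_vector_mul_assoc)
  also have "\<dots> = \<sigma>\<^sup>2 *\<^sub>R v"
    unfolding v matrix_vector_mult_scaleR by (simp add: power2_eq_square)
  finally show ?thesis using v(1) by blast
qed

lemma orthogonal_gram_eigenvectors:
  fixes X :: "real^'n^'m"
  assumes v: "(transpose X ** X) *v v = a *\<^sub>R v" and w: "(transpose X ** X) *v w = b *\<^sub>R w"
    and "a \<noteq> b"
  shows "orthogonal v w"
proof -
  have "inner ((transpose X ** X) *v v) w = inner v ((transpose X ** X) *v w)"
    unfolding inner_matrix_vector_mult by (simp only: matrix_transpose_mul transpose_transpose)
  then have "(a - b) * inner v w = 0"
    unfolding v w by (simp add: algebra_simps)
  then show ?thesis using \<open>a \<noteq> b\<close> by (simp add: orthogonal_def)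
qed

text \<open>With \<open>v = w\<close> this gives the norm of \<open>X *v w\<close>; with
  \<open>v\<close> orthogonal to \<open>w\<close> it shows that the images remain
  orthogonal.\<close>

lemma inner_mult_gram_eigenvector:
  fixes X :: "real^'n^'m"
  assumes "(transpose X ** X) *v w = b *\<^sub>R w"
  shows "inner (X *v v) (X *v w) = b * inner v w"
  unfolding inner_matrix_vector_mult matrix_vector_mul_assoc assms by simp

text \<open>Right singular vectors chosen for distinct singular values are orthogonal, since
  distinct nonnegative numbers have distinct squares; an independent set is finite.\<close>

lemma finite_singular_values:
  fixes X :: "real^'n^'m"
  shows "finite (singular_values X)"
proof -
  obtain v where v: "\<And>\<sigma>. \<sigma> \<in> singular_values X \<Longrightarrow>
      norm (v \<sigma>) = 1 \<and> (transpose X ** X) *v v \<sigma> = \<sigma>\<^sup>2 *\<^sub>R v \<sigma>"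
    using singular_value_eigenvector[of _ X] by metis
  have orth: "orthogonal (v \<sigma>) (v \<tau>)"
    if "\<sigma> \<in> singular_values X" "\<tau> \<in> singular_values X" "\<sigma> \<noteq> \<tau>" for \<sigma> \<tau>
  proof -
    have "\<sigma>\<^sup>2 \<noteq> \<tau>\<^sup>2" using that by (auto simp: singular_values_def)
    then show ?thesis using that v orthogonal_gram_eigenvectors by blast
  qed
  have inj: "inj_on v (singular_values X)"
  proof (rule inj_onI, rule ccontr)
    fix \<sigma> \<tau> assume *: "\<sigma> \<in> singular_values X" "\<tau> \<in> singular_values X" "v \<sigma> = v \<tau>" "\<sigma> \<noteq> \<tau>"
    then show False using orth[of \<sigma> \<tau>] v[of \<sigma>] by (auto simp: orthogonal_self)
  qed
  have "pairwise orthogonal (v ` singular_values X)"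
    using orth by (auto simp: pairwise_def)
  moreover have "0 \<notin> v ` singular_values X"
    using v by force
  ultimately have "finite (v ` singular_values X)"
    using pairwise_orthogonal_independent independent_imp_finite by blast
  then show ?thesis using inj by (rule finite_imageD)
qed

text \<open>The set \<open>I\<close> collects orthonormal bases of the Gram eigenspaces for the
  positive singular values. Each \<sigma> is counted with its multiplicity, because
  \<open>norm (X *v w)\<close> equals \<sigma> for every \<open>w\<close> in the basis belonging to
  \<sigma>.\<close>

lemma nuclear_norm_eq_sum_norm:
  fixes X :: "real^'n^'m"
  obtains I where "finite I" "pairwise orthogonal I" "\<And>w. w \<in> I \<Longrightarrow> norm w = 1"
    "pairwise (\<lambda>v w. orthogonal (X *v v) (X *v w)) I" "\<And>w. w \<in> I \<Longrightarrow> X *v w \<noteq> 0"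
    "nuclear_norm X = (\<Sum>w\<in>I. norm (X *v w))"
proof -
  define E where "E \<sigma> = {v. (transpose X ** X) *v v = \<sigma>\<^sup>2 *\<^sub>R v}" for \<sigma>
  have "subspace (E \<sigma>)" for \<sigma>
    by (auto simp: E_def subspace_def matrix_vector_right_distrib matrix_vector_mult_scaleR scaleR_add_right)
  then have "\<exists>B. B \<subseteq> E \<sigma> \<and> pairwise orthogonal B \<and> (\<forall>w\<in>B. norm w = 1) \<and> finite B \<and> card B = dim (E \<sigma>)" for \<sigma>
    by (metis orthonormal_basis_subspace independent_imp_finite)
  then obtain B where B: "\<And>\<sigma>. B \<sigma> \<subseteq> E \<sigma>" "\<And>\<sigma>. pairwise orthogonal (B \<sigma>)"
    "\<And>\<sigma> w. w \<in> B \<sigma> \<Longrightarrow> norm w = 1" "\<And>\<sigma>. finite (B \<sigma>)" "\<And>\<sigma>. card (B \<sigma>) = dim (E \<sigma>)"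
    by metis
  \<comment> \<open>Dropping 0 leaves the sum unchanged and makes every image \<open>X *v w\<close>
    nonzero, so that it can be normalised.\<close>
  define S where "S = singular_values X - {0}"
  have finS: "finite S" by (simp add: S_def finite_singular_values)
  have pos: "\<sigma> > 0" if "\<sigma> \<in> S" for \<sigma>
    using that by (auto simp: S_def singular_values_def)
  define I where "I = (\<Union>\<sigma>\<in>S. B \<sigma>)"
  have eig: "(transpose X ** X) *v w = \<sigma>\<^sup>2 *\<^sub>R w" if "w \<in> B \<sigma>" for w \<sigma>
    using that B(1) by (auto simp: E_def)
  have n1: "norm w = 1" if "w \<in> I" for w using that B(3) by (auto simp: I_def)
  have orth: "orthogonal v w" if "v \<in> B \<sigma>" "w \<in> B \<tau>" "\<sigma> \<in> S" "\<tau> \<in> S" "v \<noteq> w" for v w \<sigma> \<tau>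
  proof (cases "\<sigma> = \<tau>")
    case True
    then show ?thesis using B(2)[of \<sigma>] that by (auto simp: pairwise_def)
  next
    case False
    then have "\<sigma>\<^sup>2 \<noteq> \<tau>\<^sup>2" using pos that(3,4) by (meson less_imp_le power2_eq_imp_eq)
    then show ?thesis using orthogonal_gram_eigenvectors eig that(1,2) by blast
  qed
  have pI: "pairwise orthogonal I"
    using orth unfolding I_def pairwise_def by blast
  have disj: "B \<sigma> \<inter> B \<tau> = {}" if "\<sigma> \<in> S" "\<tau> \<in> S" "\<sigma> \<noteq> \<tau>" for \<sigma> \<tau>
  proof (rule ccontr)
    assume "B \<sigma> \<inter> B \<tau> \<noteq> {}"
    then obtain w where w: "w \<in> B \<sigma>" "w \<in> B \<tau>" by blast
    have "\<sigma>\<^sup>2 \<noteq> \<tau>\<^sup>2" using pos that by (meson less_imp_le power2_eq_imp_eq)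
    then have "orthogonal w w" using orthogonal_gram_eigenvectors eig w by blast
    then show False using B(3)[OF w(1)] by (auto simp: orthogonal_self)
  qed
  have norm: "norm (X *v w) = \<sigma>" if "w \<in> B \<sigma>" "\<sigma> \<in> S" for w \<sigma>
    using inner_mult_gram_eigenvector[OF eig[OF that(1)], of w] B(3)[OF that(1)] pos[OF that(2)]
    by (simp add: norm_eq_sqrt_inner)
  have "nuclear_norm X = (\<Sum>\<sigma>\<in>S. real (dim (E \<sigma>)) * \<sigma>)"
    unfolding nuclear_norm_def E_def S_def
    by (rule sum.mono_neutral_right) (auto simp: finite_singular_values)
  also have "\<dots> = (\<Sum>\<sigma>\<in>S. \<Sum>w\<in>B \<sigma>. norm (X *v w))"
    by (simp add: norm B(5) cong: sum.cong)
  also have "\<dots> = (\<Sum>w\<in>I. norm (X *v w))"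
    unfolding I_def using finS B(4) disj by (intro sum.UNION_disjoint[symmetric]) auto
  finally have "nuclear_norm X = (\<Sum>w\<in>I. norm (X *v w))" .
  moreover have "pairwise (\<lambda>v w. orthogonal (X *v v) (X *v w)) I"
  proof (rule pairwiseI)
    fix v w assume vw: "v \<in> I" "w \<in> I" "v \<noteq> w"
    then obtain \<tau> where "w \<in> B \<tau>" by (auto simp: I_def)
    then show "orthogonal (X *v v) (X *v w)"
      using inner_mult_gram_eigenvector[OF eig, of w \<tau> v] pI vw by (auto simp: orthogonal_def pairwise_def)
  qed
  moreover have "X *v w \<noteq> 0" if "w \<in> I" for w
    using that norm pos by (force simp: I_def)
  moreover have "finite I" using finS B(4) by (simp add: I_def)
  ultimately show thesis using pI n1 that by blast
qed

section \<open>Nuclear norm of a product around a compact SVD\<close>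

lemma diagonal_mult_vec:
  fixes S :: "real^'k^'k"
  assumes "\<forall>i j. i \<noteq> j \<longrightarrow> S $ i $ j = 0"
  shows "(S *v y) $ j = S $ j $ j * y $ j"
proof -
  have "(S *v y) $ j = (\<Sum>i\<in>UNIV. S $ j $ i * y $ i)"
    by (simp add: matrix_vector_mult_def)
  also have "\<dots> = (\<Sum>i\<in>UNIV. if i = j then S $ j $ j * y $ j else 0)"
    using assms by (intro sum.cong) auto
  finally show ?thesis by simp
qed

lemma norm_column_orthonormal:
  fixes U :: "real^'k^'m"
  assumes "transpose U ** U = mat 1"
  shows "norm (column j U) = 1"
  using norm_orthonormal_columns_mult[OF assms, of "axis j 1"]
  by (simp add: matrix_vector_mul_component matrix_vector_mult_basis)

text \<open>Bessel's inequality in the form that fits the Cauchy-Schwarz inequality for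
  \<open>L2_set\<close>.\<close>

lemma inner_L2_set_bessel:
  fixes f :: "'i \<Rightarrow> 'a::real_inner"
  assumes "finite I" "pairwise (\<lambda>i j. orthogonal (f i) (f j)) I" "\<And>i. i \<in> I \<Longrightarrow> norm (f i) = 1"
  shows "L2_set (\<lambda>i. inner x (f i)) I \<le> norm x"
  unfolding L2_set_def using Bessel_inequality[OF assms, of x] by (intro real_le_lsqrt) (auto intro: sum_nonneg)

text \<open>The product is the sum over \<open>j\<close> of \<open>S $ j $ j\<close> times the outer
  product of \<open>a j\<close> and \<open>b j\<close>. Expanding its nuclear norm gives each
  \<open>S $ j $ j\<close> a weight, which Cauchy-Schwarz and Bessel bound by
  \<open>norm (a j) * norm (b j)\<close>.\<close>

lemma nuclear_norm_sandwich_le: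
  fixes P :: "real^'m^'m" and R :: "real^'n^'n" and U :: "real^'k^'m" and V :: "real^'k^'n"
  assumes U: "transpose U ** U = mat 1" and V: "transpose V ** V = mat 1"
    and S: "\<forall>i j. i \<noteq> j \<longrightarrow> S $ i $ j = 0" "\<forall>i. S $ i $ i \<ge> 0"
    and P: "\<And>x. norm (P *v x) \<le> p * norm x" and R: "\<And>x. norm (transpose R *v x) \<le> r * norm x"
  shows "nuclear_norm (P ** (U ** S ** transpose V) ** R) \<le> p * r * trace S"
proof -
  let ?X = "P ** (U ** S ** transpose V) ** R"
  obtain I where I: "finite I" "pairwise orthogonal I" "\<And>w. w \<in> I \<Longrightarrow> norm w = 1"
    "pairwise (\<lambda>v w. orthogonal (?X *v v) (?X *v w)) I" "\<And>w. w \<in> I \<Longrightarrow> ?X *v w \<noteq> 0"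
    "nuclear_norm ?X = (\<Sum>w\<in>I. norm (?X *v w))"
    by (rule nuclear_norm_eq_sum_norm[of ?X]) blast
  \<comment> \<open>The normalised images play the part of left singular vectors.\<close>
  define g where "g w = ?X *v w /\<^sub>R norm (?X *v w)" for w
  define a where "a j = P *v column j U" for j
  define b where "b j = transpose R *v column j V" for j
  have g1: "norm (g w) = 1" if "w \<in> I" for w
    using I(5)[OF that] by (simp add: g_def)
  have gorth: "pairwise (\<lambda>v w. orthogonal (g v) (g w)) I"
    using I(4) by (auto simp: pairwise_def g_def orthogonal_def)
  have a: "norm (a j) \<le> p" and b: "norm (b j) \<le> r" for j
    using P[of "column j U"] R[of "column j V"] U V
    by (simp_all add: a_def b_def norm_column_orthonormal del: transpose_matrix_vector)
  \<comment> \<open>Nonnegativity of \<open>p\<close> and \<open>r\<close> comes from the columns of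
    \<open>U\<close> and \<open>V\<close>, whose images have norms at most \<open>p\<close> and
    \<open>r\<close>.\<close>
  then have pr: "0 \<le> p" "0 \<le> r" by (meson norm_ge_zero order_trans)+
  have comp: "(transpose Y *v x) $ j = inner (column j Y) x" for Y :: "real^'x^'y" and x j
    by (simp add: matrix_vector_mult_def transpose_def column_def inner_vec_def)
  \<comment> \<open>A norm is the inner product with its own direction; this makes the expression
    linear in \<open>S\<close>.\<close>
  have key: "norm (?X *v w) = (\<Sum>j\<in>UNIV. S $ j $ j * (inner (a j) (g w) * inner (b j) w))"
    if "w \<in> I" for w
  proof -
    have "norm (?X *v w) = inner (g w) (?X *v w)"
      using I(5)[OF that] by (simp add: g_def power2_norm_eq_inner[symmetric] power2_eq_square)
    also have "\<dots> = inner (transpose U *v (transpose P *v g w)) (S *v (transpose V *v (R *v w)))"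
      by (simp only: inner_matrix_vector_mult matrix_transpose_mul transpose_transpose matrix_vector_mul_assoc matrix_mul_assoc)
    also have "\<dots> = (\<Sum>j\<in>UNIV. (transpose U *v (transpose P *v g w)) $ j * (S $ j $ j * (transpose V *v (R *v w)) $ j))"
      unfolding inner_vec_def diagonal_mult_vec[OF S(1)] by simp
    also have "\<dots> = (\<Sum>j\<in>UNIV. S $ j $ j * (inner (a j) (g w) * inner (b j) w))"
      unfolding comp a_def b_def inner_matrix_vector_mult transpose_transpose by (simp add: mult_ac)
    finally show ?thesis .
  qed
  have weight: "(\<Sum>w\<in>I. inner (a j) (g w) * inner (b j) w) \<le> p * r" for j
  proof -
    have "(\<Sum>w\<in>I. inner (a j) (g w) * inner (b j) w) \<le> (\<Sum>w\<in>I. \<bar>inner (a j) (g w)\<bar> * \<bar>inner (b j) w\<bar>)"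
      by (intro sum_mono) (metis abs_ge_self abs_mult)
    also have "\<dots> \<le> L2_set (\<lambda>w. inner (a j) (g w)) I * L2_set (\<lambda>w. inner (b j) w) I"
      by (rule L2_set_mult_ineq)
    also have "\<dots> \<le> norm (a j) * norm (b j)"
      using inner_L2_set_bessel[OF I(1) gorth g1] inner_L2_set_bessel[of I "\<lambda>w. w"] I(1-3)
      by (intro mult_mono) auto
    also have "\<dots> \<le> p * r" using a b pr by (intro mult_mono) auto
    finally show ?thesis .
  qed
  \<comment> \<open>Exchanging the sums isolates the weight of each diagonal entry; nonnegativity of
    these entries then permits the bound.\<close>
  have "nuclear_norm ?X = (\<Sum>j\<in>UNIV. S $ j $ j * (\<Sum>w\<in>I. inner (a j) (g w) * inner (b j) w))"
    unfolding I(6) by (simp add: key sum_distrib_left sum.swap[of _ I] cong: sum.cong)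
  also have "\<dots> \<le> (\<Sum>j\<in>UNIV. S $ j $ j * (p * r))"
    by (intro sum_mono mult_left_mono weight) (simp add: S(2))
  also have "\<dots> = p * r * trace S"
    by (simp add: trace_def sum_distrib_left mult_ac)
  finally show ?thesis .
qed

subsection \<open>Semi-orthogonal factors\<close>

lemma inner_matrix_mult_left:
  fixes P :: "real^'k^'m" and X :: "real^'n^'k"
  shows "inner (P ** X) Y = inner X (transpose P ** Y)"
  by (simp add: inner_eq_trace_transpose matrix_transpose_mul matrix_mul_assoc)

lemma inner_matrix_mult_right:
  fixes X :: "real^'k^'m" and R :: "real^'n^'k"
  shows "inner (X ** R) Y = inner X (Y ** transpose R)"
proof -
  have "trace (transpose R ** (transpose X ** Y)) = trace ((transpose X ** Y) ** transpose R)"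
    by (rule trace_mul_sym)
  then show ?thesis
    by (simp add: inner_eq_trace_transpose matrix_transpose_mul matrix_mul_assoc)
qed

lemma norm_transpose_matrix:
  fixes X :: "real^'n^'m"
  shows "norm (transpose X) = norm X"
  unfolding norm_eq_sqrt_trace transpose_transpose by (subst trace_mul_sym) (rule refl)

lemma norm_matrix_power2_columns:
  fixes X :: "real^'n^'m"
  shows "(norm X)\<^sup>2 = (\<Sum>j\<in>UNIV. (norm (column j X))\<^sup>2)"
proof -
  have "(norm X)\<^sup>2 = (\<Sum>i\<in>UNIV. \<Sum>j\<in>UNIV. X $ i $ j * X $ i $ j)"
    unfolding power2_norm_eq_inner by (simp add: inner_vec_def)
  also have "\<dots> = (\<Sum>j\<in>UNIV. \<Sum>i\<in>UNIV. X $ i $ j * X $ i $ j)"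
    by (rule sum.swap)
  finally show ?thesis
    unfolding power2_norm_eq_inner by (simp add: inner_vec_def column_def)
qed

text \<open>A bound on vectors passes to the Frobenius norm because \<open>P\<close> acts on each
  column of \<open>X\<close> separately.\<close>

lemma norm_matrix_mult_le:
  fixes P :: "real^'k^'m" and X :: "real^'n^'k"
  assumes P: "\<And>x. norm (P *v x) \<le> p * norm x" and "0 \<le> p"
  shows "norm (P ** X) \<le> p * norm X"
proof (rule power2_le_imp_le)
  have col: "column j (P ** X) = P *v column j X" for j
    by (simp add: vec_eq_iff column_def matrix_matrix_mult_def matrix_vector_mult_def)
  show "(norm (P ** X))\<^sup>2 \<le> (p * norm X)\<^sup>2"
    unfolding power_mult_distrib norm_matrix_power2_columns col sum_distrib_left
    unfolding power_mult_distrib[symmetric]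
    by (intro sum_mono power_mono P) auto
qed (simp add: \<open>0 \<le> p\<close>)

text \<open>The factor \<open>U\<close> cancels and leaves the Frobenius norm of \<open>V\<close>,
  whose square is the trace of the identity of size \<open>CARD('k)\<close>.\<close>

lemma norm_polar_factor:
  fixes U :: "real^'k^'m" and V :: "real^'k^'n"
  assumes "transpose U ** U = mat 1" "transpose V ** V = mat 1"
  shows "norm (U ** transpose V) = sqrt (real CARD('k))"
proof -
  have "(norm (U ** transpose V))\<^sup>2 = inner (transpose V) (transpose V)"
    unfolding power2_norm_eq_inner inner_matrix_mult_left by (simp add: matrix_mul_assoc assms(1))
  also have "\<dots> = (norm V)\<^sup>2"
    by (simp add: power2_norm_eq_inner[symmetric] norm_transpose_matrix)
  also have "\<dots> = real CARD('k)"
    by (simp add: power2_norm_eq_inner inner_eq_trace_transpose assms(2) trace_I)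
  finally show ?thesis by (metis norm_ge_zero real_sqrt_unique)
qed

text \<open>Moving \<open>U\<close> and \<open>V\<close> across the inner product leaves
  \<open>S\<close> paired with the identity.\<close>

lemma inner_polar_factor:
  fixes U :: "real^'k^'m" and V :: "real^'k^'n"
  assumes U: "transpose U ** U = mat 1" and V: "transpose V ** V = mat 1"
  shows "inner (U ** S ** transpose V) (U ** transpose V) = trace S"
proof -
  have "inner (U ** S ** transpose V) (U ** transpose V)
      = inner (S ** transpose V) (transpose U ** (U ** transpose V))"
    by (simp only: inner_matrix_mult_left matrix_mul_assoc[symmetric])
  also have "\<dots> = inner (S ** transpose V) (transpose V)"
    by (simp add: matrix_mul_assoc U)
  also have "\<dots> = inner S (mat 1)"
    unfolding inner_matrix_mult_right transpose_transpose V ..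
  also have "\<dots> = trace S"
    by (simp add: inner_eq_trace_transpose) (simp add: trace_def transpose_def)
  finally show ?thesis .
qed

section \<open>Extreme nonzero singular values of products with a polar factor\<close>

text \<open>Ensures that the maximum and minimum in \<open>cond_plus\<close> are taken over a
  nonempty set. A nonzero Gram matrix has a nonzero eigenvalue \<open>d $ i\<close>; for a unit
  eigenvector \<open>w\<close> it is the square of \<open>norm (X *v w)\<close>, and
  \<open>w\<close> with its normalised image forms a singular pair.\<close>

lemma singular_values_nonzero:
  fixes X :: "real^'n^'m"
  assumes "X \<noteq> 0"
  shows "singular_values X - {0} \<noteq> {}"
proof -
  have "transpose (transpose X ** X) = transpose X ** X"
    by (simp add: matrix_transpose_mul)
  then obtain W d where W: "orthogonal_matrix W" and eq: "transpose X ** X = W ** diag_matrix d ** transpose W"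
    by (rule spectral_decomposition)
  have WW: "transpose W ** W = mat 1" using W by (simp add: orthogonal_matrix_def)
  have "d \<noteq> 0"
  proof
    assume "d = 0"
    then have "diag_matrix d = 0" by (simp add: vec_eq_iff diag_matrix_def)
    then have "transpose X ** X = 0" unfolding eq by simp
    then have "inner X X = 0" by (simp add: inner_eq_trace_transpose trace_def)
    with assms show False by simp
  qed
  then obtain i where i: "d $ i \<noteq> 0" by (auto simp: vec_eq_iff)
  define w where "w = W *v axis i 1"
  have n1: "norm w = 1"
    unfolding w_def using norm_orthonormal_columns_mult[OF WW, of "axis i 1"] by simp
  have "diag_matrix d *v axis i 1 = d $ i *\<^sub>R axis i 1"
    by (simp add: vec_eq_iff diag_matrix_mult_vec axis_def)
  then have eig: "(transpose X ** X) *v w = d $ i *\<^sub>R w"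
    unfolding eq w_def matrix_vector_mul_assoc
    by (simp add: matrix_mul_assoc[symmetric] WW) (simp add: matrix_vector_mul_assoc[symmetric] matrix_vector_mult_scaleR)
  have "(norm (X *v w))\<^sup>2 = d $ i"
    using inner_mult_gram_eigenvector[OF eig, of w] n1 by (simp add: power2_norm_eq_inner norm_eq_1)
  then have di: "d $ i = (norm (X *v w))\<^sup>2" ..
  define \<sigma> where "\<sigma> = norm (X *v w)"
  have \<sigma>: "\<sigma> \<noteq> 0" "\<sigma> \<ge> 0" using i di by (auto simp: \<sigma>_def)
  have "transpose X *v (X *v w /\<^sub>R \<sigma>) = \<sigma> *\<^sub>R w"
    unfolding matrix_vector_mult_scaleR matrix_vector_mul_assoc eig
    using \<sigma> by (simp add: di \<sigma>_def[symmetric] power2_eq_square)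
  moreover have "norm (X *v w /\<^sub>R \<sigma>) = 1" "X *v w = \<sigma> *\<^sub>R (X *v w /\<^sub>R \<sigma>)"
    using \<sigma> by (simp_all add: \<sigma>_def)
  ultimately have "\<sigma> \<in> singular_values X"
    unfolding singular_values_def using n1 \<sigma>(2) by blast
  with \<sigma>(1) show ?thesis by blast
qed

lemma cond_plus_le:
  fixes X :: "real^'n^'m"
  assumes "X \<noteq> 0" "0 < lo"
    and "\<And>\<sigma>. \<sigma> \<in> singular_values X \<Longrightarrow> lo \<le> \<sigma>" "\<And>\<sigma>. \<sigma> \<in> singular_values X \<Longrightarrow> \<sigma> \<le> hi"
  shows "cond_plus X \<le> hi / lo"
proof -
  let ?S = "singular_values X - {0}"
  have fin: "finite ?S" "?S \<noteq> {}"
    using finite_singular_values singular_values_nonzero[OF assms(1)] by auto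
  have "Max ?S \<le> hi" "lo \<le> Min ?S"
    using fin assms(3,4) by auto
  moreover have "0 \<le> hi"
    using fin(2) assms(2-4) by force
  ultimately show ?thesis
    unfolding cond_plus_def using assms(2) by (intro frac_le) auto
qed

text \<open>The left side squared is the inner product of \<open>x\<close> with
  \<open>V *v (transpose V *v x)\<close>, and \<open>V\<close> preserves norms; after Cauchy-Schwarz
  one factor cancels.\<close>

lemma norm_transpose_orthonormal_mult_le:
  fixes V :: "real^'k^'n"
  assumes "transpose V ** V = mat 1"
  shows "norm (transpose V *v x) \<le> norm x"
proof -
  have "(norm (transpose V *v x))\<^sup>2 = inner x (V *v (transpose V *v x))"
    unfolding power2_norm_eq_inner using inner_matrix_vector_mult[of "transpose V" x]
    by (simp only: transpose_transpose)
  also have "\<dots> \<le> norm x * norm (V *v (transpose V *v x))"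
    by (rule norm_cauchy_schwarz)
  also have "\<dots> = norm x * norm (transpose V *v x)"
    by (simp only: norm_orthonormal_columns_mult[OF assms])
  finally show ?thesis
    by (metis mult_le_cancel_right norm_ge_zero not_less order_antisym_conv power2_eq_square)
qed

text \<open>Equality of the dimensions makes the injective map \<open>V\<close> surjective, so
  \<open>x = V *v y\<close> and \<open>transpose V\<close> returns \<open>y\<close>.\<close>

lemma norm_transpose_orthonormal_mult_eq:
  fixes V :: "real^'k^'n"
  assumes V: "transpose V ** V = mat 1" and card: "CARD('k) = CARD('n)"
  shows "norm (transpose V *v x) = norm x"
proof -
  have "inj ((*v) V)" using V matrix_left_invertible_injective by blast
  then have "dim (range ((*v) V)) = CARD('n)"
    using dim_image_eq[of "(*v) V" UNIV] card by (simp add: inj_on_subset)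
  then have "range ((*v) V) = UNIV"
    using dim_eq_full[of "range ((*v) V)"] by (simp add: linear_subspace_image subspace_UNIV span_eq_iff[THEN iffD2])
  then obtain y where y: "x = V *v y" by blast
  have "transpose V *v x = y"
    unfolding y matrix_vector_mul_assoc V by simp
  then show ?thesis using norm_orthonormal_columns_mult[OF V, of y] y by simp
qed

text \<open>When the inner dimension is that of the domain, the polar factor is an isometry, so the
  lower bounds of \<open>P\<close> and \<open>R\<close> multiply.\<close>

lemma norm_sandwich_mult_ge:
  fixes P :: "real^'m^'m" and R :: "real^'n^'n" and U :: "real^'k^'m" and V :: "real^'k^'n"
  assumes U: "transpose U ** U = mat 1" and V: "transpose V ** V = mat 1" and card: "CARD('k) = CARD('n)"
    and P: "\<And>x. p * norm x \<le> norm (P *v x)" "0 \<le> p" and R: "\<And>x. r * norm x \<le> norm (R *v x)"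
  shows "p * r * norm x \<le> norm ((P ** (U ** transpose V) ** R) *v x)"
proof -
  have "p * (r * norm x) \<le> p * norm (R *v x)"
    using R P(2) by (rule mult_left_mono)
  also have "norm (R *v x) = norm (U *v (transpose V *v (R *v x)))"
    by (simp only: norm_orthonormal_columns_mult[OF U] norm_transpose_orthonormal_mult_eq[OF V card])
  also have "p * \<dots> \<le> norm (P *v (U *v (transpose V *v (R *v x))))" by (rule P)
  finally show ?thesis by (simp only: matrix_vector_mul_assoc matrix_mul_assoc mult.assoc)
qed

lemma norm_sandwich_mult_le:
  fixes P :: "real^'m^'m" and R :: "real^'n^'n" and U :: "real^'k^'m" and V :: "real^'k^'n"
  assumes U: "transpose U ** U = mat 1" and V: "transpose V ** V = mat 1"
    and P: "\<And>x. norm (P *v x) \<le> p * norm x" "0 \<le> p" and R: "\<And>x. norm (R *v x) \<le> r * norm x"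
  shows "norm ((P ** (U ** transpose V) ** R) *v x) \<le> p * r * norm x"
proof -
  have "norm (P *v (U *v (transpose V *v (R *v x)))) \<le> p * norm (U *v (transpose V *v (R *v x)))" by (rule P)
  also have "norm (U *v (transpose V *v (R *v x))) \<le> norm (R *v x)"
    by (simp only: norm_orthonormal_columns_mult[OF U] norm_transpose_orthonormal_mult_le[OF V])
  also have "norm (R *v x) \<le> r * norm x" by (rule R)
  finally show ?thesis
    using P(2) by (simp only: matrix_vector_mul_assoc matrix_mul_assoc mult.assoc mult_left_mono)
qed

text \<open>A singular value is at once the norm of \<open>X *v v\<close> and of
  \<open>transpose X *v u\<close>, so its lower bound may be proved on whichever side has the
  smaller dimension. The scale \<open>c\<close> cancels in the ratio.\<close>

lemma cond_plus_sandwich_le: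
  fixes P :: "real^'m^'m" and R :: "real^'n^'n" and U :: "real^'k^'m" and V :: "real^'k^'n"
  assumes U: "transpose U ** U = mat 1" and V: "transpose V ** V = mat 1"
    and card: "CARD('k) = min CARD('m) CARD('n)"
    and sym: "transpose P = P" "transpose R = R"
    and P: "\<And>x. p1 * norm x \<le> norm (P *v x)" "\<And>x. norm (P *v x) \<le> p2 * norm x" "0 < p1" "0 \<le> p2"
    and R: "\<And>x. r1 * norm x \<le> norm (R *v x)" "\<And>x. norm (R *v x) \<le> r2 * norm x" "0 < r1"
    and X: "X = c *\<^sub>R (P ** (U ** transpose V) ** R)" "X \<noteq> 0" "0 < c"
  shows "cond_plus X \<le> (p2 * r2) / (p1 * r1)"
proof -
  let ?Y = "P ** (U ** transpose V) ** R"
  have Yt: "transpose ?Y = R ** (V ** transpose U) ** P"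
    by (simp add: matrix_transpose_mul sym matrix_mul_assoc)
  have XY: "X *v v = c *\<^sub>R (?Y *v v)" "transpose X *v u = c *\<^sub>R (transpose ?Y *v u)" for u v
    unfolding X(1) transpose_scalar scaleR_matrix_vector_assoc by (rule refl)+
  have "c * (p1 * r1) \<le> \<sigma> \<and> \<sigma> \<le> c * (p2 * r2)" if "\<sigma> \<in> singular_values X" for \<sigma>
  proof -
    obtain u v where "\<sigma> \<ge> 0" and uv: "norm u = 1" "norm v = 1" "X *v v = \<sigma> *\<^sub>R u" "transpose X *v u = \<sigma> *\<^sub>R v"
      using \<open>\<sigma> \<in> singular_values X\<close> unfolding singular_values_def by blast
    have "norm (X *v v) = \<sigma>" "norm (transpose X *v u) = \<sigma>"
      unfolding uv using uv(1,2) \<open>\<sigma> \<ge> 0\<close> by simp_all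
    then have \<sigma>: "\<sigma> = c * norm (?Y *v v)" "\<sigma> = c * norm (transpose ?Y *v u)"
      unfolding XY using X(3) by simp_all
    have "norm (?Y *v v) \<le> p2 * r2"
      using norm_sandwich_mult_le[OF U V P(2,4) R(2), of v] uv(2) by simp
    moreover have "p1 * r1 \<le> norm (?Y *v v) \<or> p1 * r1 \<le> norm (transpose ?Y *v u)"
    \<comment> \<open>In the first case the polar factor preserves norms; in the second its
      transpose does.\<close>
    proof (cases "CARD('n) \<le> CARD('m)")
      case True
      then show ?thesis
        using norm_sandwich_mult_ge[OF U V _ P(1) less_imp_le[OF P(3)] R(1), of v] card uv(2) by simp
    next
      case False
      then show ?thesis unfolding Yt
        using norm_sandwich_mult_ge[OF V U _ R(1) less_imp_le[OF R(3)] P(1), of u] card uv(1)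
        by (simp add: mult.commute)
    qed
    ultimately show ?thesis using \<sigma> X(3) by (metis less_imp_le mult_left_mono)
  qed
  then have "cond_plus X \<le> (c * (p2 * r2)) / (c * (p1 * r1))"
    using X(2,3) P(3) R(3) by (intro cond_plus_le) auto
  then show ?thesis using X(3) by simp
qed

section \<open>Gain and conditioning of the normalised direction\<close>

theorem proposition5:
  fixes A :: "real^'n^'n" and B :: "real^'m^'m"
    and M C Q D0 D :: "real^'n^'m"
    and U :: "real^'k^'m" and S :: "real^'k^'k" and V :: "real^'k^'n"
    and \<alpha> K :: real
  assumes "symmetric_positive_definite A"
    and "symmetric_positive_definite B"
    and "0 \<le> \<alpha>" and "\<alpha> \<le> 1/2"
    and "M \<noteq> 0"
    and "C = spd_powr B (-\<alpha>) ** M ** spd_powr A (-\<alpha>)"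
    and "compact_svd C U S V"
    and "Q = U ** transpose V"
    and "D0 = spd_powr B (-\<alpha>) ** Q ** spd_powr A (-\<alpha>)"
    and "D = (sqrt (real (min CARD('m) CARD('n))) / norm D0) *\<^sub>R D0"
    and "K = cond2 A * cond2 B"
  shows "trace (transpose M ** D) \<ge> K powr (-\<alpha>) * nuclear_norm M
    \<and> cond_plus D \<le> K powr \<alpha>"
proof -
  let ?P = "spd_powr B (-\<alpha>)" and ?R = "spd_powr A (-\<alpha>)" and ?k = "real (min CARD('m) CARD('n))"
  note spd = assms(1,2)
  have card: "CARD('k) = min CARD('m) CARD('n)"
    and U: "transpose U ** U = mat 1" and V: "transpose V ** V = mat 1"
    and S: "\<forall>i j. i \<noteq> j \<longrightarrow> S $ i $ j = 0" "\<forall>i. S $ i $ i \<ge> 0"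
    and C: "C = U ** S ** transpose V"
    using assms(7) unfolding compact_svd_def by blast+
  obtain la ha where a: "0 < la" "0 < ha" "cond2 A = ha / la"
    and R: "\<And>x. ha powr (-\<alpha>) * norm x \<le> norm (?R *v x)" "\<And>x. norm (?R *v x) \<le> la powr (-\<alpha>) * norm x"
      "\<And>x. norm (spd_powr A \<alpha> *v x) \<le> ha powr \<alpha> * norm x"
    by (rule spd_powr_norm_bounds[OF spd(1)]) (use assms(3) in blast)
  obtain lb hb where b: "0 < lb" "0 < hb" "cond2 B = hb / lb"
    and P: "\<And>x. hb powr (-\<alpha>) * norm x \<le> norm (?P *v x)" "\<And>x. norm (?P *v x) \<le> lb powr (-\<alpha>) * norm x"
      "\<And>x. norm (spd_powr B \<alpha> *v x) \<le> hb powr \<alpha> * norm x"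
    by (rule spd_powr_norm_bounds[OF spd(2)]) (use assms(3) in blast)
  have inv: "spd_powr B \<alpha> ** ?P = mat 1" "?R ** spd_powr A \<alpha> = mat 1"
    using spd_powr_minus[OF spd(2), of \<alpha>] spd_powr_minus[OF spd(1), of "-\<alpha>"] by simp_all
  have sym: "transpose ?P = ?P" "transpose ?R = ?R" "transpose (spd_powr A \<alpha>) = spd_powr A \<alpha>"
    using spd by (simp_all add: transpose_spd_powr)
  \<comment> \<open>Undoing the preconditioners recovers \<open>M\<close> from \<open>C\<close>, and
    with \<open>Z = Q\<close> shows that \<open>D0\<close> is nonzero.\<close>
  have cancel: "spd_powr B \<alpha> ** (?P ** Z ** ?R) ** spd_powr A \<alpha> = Z" for Z :: "real^'n^'m"
  proof -
    have "spd_powr B \<alpha> ** (?P ** Z ** ?R) ** spd_powr A \<alpha>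
        = (spd_powr B \<alpha> ** ?P) ** Z ** (?R ** spd_powr A \<alpha>)"
      by (simp only: matrix_mul_assoc)
    then show ?thesis by (simp add: inv)
  qed
  have nQ: "norm Q = sqrt ?k"
    unfolding assms(8) norm_polar_factor[OF U V] card ..
  have k: "0 < sqrt ?k" by simp
  have "Q \<noteq> 0" using nQ k by (metis norm_zero less_irrefl)
  then have "D0 \<noteq> 0"
    using cancel[of Q] unfolding assms(9)[symmetric] by auto
  then have nD0: "0 < norm D0" by simp
  define c where "c = sqrt ?k / norm D0"
  have c: "0 < c" "D = c *\<^sub>R D0"
    using k nD0 by (simp_all add: c_def assms(10))
  have K: "K = (ha * hb) / (la * lb)"
    by (simp add: assms(11) a b)

  \<comment> \<open>The eigenvalues enter with exponent -\<alpha>, so the smallest ones,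
    \<open>lb\<close> and \<open>la\<close>, supply the upper bounds in the numerator.\<close>
  have "cond_plus D \<le> (lb powr (-\<alpha>) * la powr (-\<alpha>)) / (hb powr (-\<alpha>) * ha powr (-\<alpha>))"
    using \<open>D0 \<noteq> 0\<close> a b c
    by (intro cond_plus_sandwich_le[OF U V card sym(1,2) P(1,2) _ _ R(1,2), where c = c]) (auto simp: assms(8,9))
  also have "\<dots> = K powr \<alpha>"
    using a b by (simp add: K powr_minus powr_mult powr_divide field_simps)
  finally have cond: "cond_plus D \<le> K powr \<alpha>" .

  have "trace (transpose M ** D) = c * inner M D0"
    by (simp add: c(2) inner_eq_trace_transpose[symmetric])
  \<comment> \<open>The symmetric factors \<open>?P\<close> and \<open>?R\<close> move from
    \<open>D0\<close> to \<open>M\<close> and turn it into \<open>C\<close>.\<close>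
  also have "inner M D0 = inner C Q"
    unfolding assms(6,9) inner_matrix_mult_right[of "?P ** M"] inner_matrix_mult_left[of ?P M] sym
    by (simp only: matrix_mul_assoc)
  also have "inner C Q = trace S"
    unfolding C assms(8) by (rule inner_polar_factor[OF U V])
  finally have gain: "trace (transpose M ** D) = c * trace S" .
  have trS: "0 \<le> trace S" using S(2) by (simp add: trace_def sum_nonneg)
  \<comment> \<open>\<open>M\<close> is the SVD of \<open>C\<close> placed between the positive
    powers, which enter through the largest eigenvalues.\<close>
  have nuc: "nuclear_norm M \<le> (hb powr \<alpha> * ha powr \<alpha>) * trace S"
    using nuclear_norm_sandwich_le[OF U V S P(3), of "spd_powr A \<alpha>" "ha powr \<alpha>"] R(3)
    unfolding sym C[symmetric] assms(6) cancel by blast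
  \<comment> \<open>The available norm bound concerns multiplication from the left; transposing,
    with \<open>?R\<close> symmetric, yields the one for the right factor.\<close>
  have "norm (Q ** ?R) \<le> la powr (-\<alpha>) * norm Q"
    using norm_matrix_mult_le[of ?R "la powr (-\<alpha>)" "transpose Q"] R(2) norm_transpose_matrix[of "Q ** ?R"]
    by (simp add: matrix_transpose_mul sym norm_transpose_matrix)
  moreover have "norm D0 \<le> lb powr (-\<alpha>) * norm (Q ** ?R)"
    unfolding assms(9) matrix_mul_assoc[symmetric] by (rule norm_matrix_mult_le[OF P(2)]) simp
  ultimately have "norm D0 \<le> lb powr (-\<alpha>) * (la powr (-\<alpha>) * norm Q)"
    by (meson mult_left_mono order_trans powr_ge_zero)
  \<comment> \<open>The value \<open>norm Q = sqrt ?k\<close> cancels the numerator of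
    \<open>c\<close>, leaving only the smallest eigenvalues.\<close>
  then have "lb powr \<alpha> * la powr \<alpha> \<le> c"
    unfolding c_def using nD0 a b nQ by (simp add: powr_minus field_simps)
  \<comment> \<open>The factor \<open>K powr (-\<alpha>)\<close> converts the largest eigenvalues in
    \<open>nuc\<close> into the smallest ones that bound \<open>c\<close> from below.\<close>
  have "K powr (-\<alpha>) * nuclear_norm M \<le> K powr (-\<alpha>) * ((hb powr \<alpha> * ha powr \<alpha>) * trace S)"
    using nuc by (intro mult_left_mono) auto
  also have "\<dots> = (lb powr \<alpha> * la powr \<alpha>) * trace S"
    using a b by (simp add: K powr_minus powr_mult powr_divide field_simps)
  also have "\<dots> \<le> c * trace S"
    using \<open>lb powr \<alpha> * la powr \<alpha> \<le> c\<close> trS by (rule mult_right_mono)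
  finally show ?thesis using cond gain by simp
qed

end
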